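(* For every $n\ge 3$, the diameter of the 1-skeleton of the polytope $\operatorname{PSB}(n)$ is at most $4$; that is, any two vertices of $\operatorname{PSB}(n)$ are joined by a path of at most $4$ edges of the 1-skeleton.
   Context: Let $K_n=(V,E)$ be the complete directed graph on the vertex set $V=\{1,\dots,n\}$ (cities), with arc set $E$ consisting of all ordered pairs $(u,v)$, $u\neq v$. A Hamiltonian tour $\tau$ is a directed cycle through all cities; $\tau(i)$ denotes the successor of city $i$, $\tau^{-1}(i)$ its predecessor, and $\tau^{k}(i)$, $\tau^{-k}(i)$ the $k$-th successor and $k$-th predecessor. A city $i$ is a peak if $\tau^{-1}(i)<i$ and $\tau(i)<i$. A city $i$ is a step-back peak if either ($\tau^{-1}(i)<i$, $\tau(i)=i-1$, $\tau^2(i)>i$) or ($\tau^{-2}(i)>i$, $\tau^{-1}(i)=i-1$, $\tau(i)<i$). A proper peak is a peak that is not a step-back peak. A pyramidal tour with step-backs is a Hamiltonian tour whose only proper peak is $n$. For a tour $x$, its characteristic vector $\mathbf{v}(x)\in\mathbb{R}^{E}$ has $\mathbf{v}(x)_e=1$ if the arc $e$ is used by $x$ and $0$ otherwise. The polytope of pyramidal tours with step-backs is $\operatorname{PSB}(n)=\operatorname{conv}\{\mathbf{v}(x) : x \text{ is a pyramidal tour with step-backs in } K_n\}$. The 1-skeleton of a polytope is the graph whose vertices are the vertices of the polytope and whose edges are the one-dimensional faces (geometric edges) of the polytope. The diameter of a graph is the maximum, over pairs of vertices, of the edge distance between them. *)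

theory Defs
  imports
    "HOL-Analysis.Analysis"
    "HOL-Combinatorics.Combinatorics"
    "HOL-Library.Extended_Nat"
begin

definition Kn_arcs :: "nat \<Rightarrow> (nat \<times> nat) set" where
  "Kn_arcs n = {(u, v). u \<in> {1..n} \<and> v \<in> {1..n} \<and> u \<noteq> v}"

text \<open>A tour is represented by its successor function, which is a permutation of the cities
  consisting of a single cycle through all of them; \<^term>\<open>inv \<tau>\<close> is the predecessor function.\<close>

definition hamiltonian_tour :: "nat \<Rightarrow> (nat \<Rightarrow> nat) \<Rightarrow> bool" where
  "hamiltonian_tour n \<tau> \<longleftrightarrow> \<tau> permutes {1..n} \<and> cyclic_on \<tau> {1..n}"

definition peak :: "(nat \<Rightarrow> nat) \<Rightarrow> nat \<Rightarrow> bool" where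
  "peak \<tau> i \<longleftrightarrow> inv \<tau> i < i \<and> \<tau> i < i"

text \<open>For cities we have \<open>i \<ge> 1\<close>, so the natural-number subtraction \<open>i - 1\<close> is not truncated.\<close>

definition step_back_peak :: "(nat \<Rightarrow> nat) \<Rightarrow> nat \<Rightarrow> bool" where
  "step_back_peak \<tau> i \<longleftrightarrow>
     (inv \<tau> i < i \<and> \<tau> i = i - 1 \<and> \<tau> (\<tau> i) > i) \<or>
     (inv \<tau> (inv \<tau> i) > i \<and> inv \<tau> i = i - 1 \<and> \<tau> i < i)"

definition proper_peak :: "(nat \<Rightarrow> nat) \<Rightarrow> nat \<Rightarrow> bool" where
  "proper_peak \<tau> i \<longleftrightarrow> peak \<tau> i \<and> \<not> step_back_peak \<tau> i"

definition psb_tour :: "nat \<Rightarrow> (nat \<Rightarrow> nat) \<Rightarrow> bool" where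
  "psb_tour n \<tau> \<longleftrightarrow> hamiltonian_tour n \<tau> \<and> {i \<in> {1..n}. proper_peak \<tau> i} = {n}"

text \<open>The space of real vectors indexed by the arcs of the complete digraph is rendered as
  \<^typ>\<open>real ^ 'e\<close>, where \<open>ends\<close> is a bijection from the index type \<^typ>\<open>'e\<close> onto
  \<^term>\<open>Kn_arcs n\<close> that names the arc (tail, head) belonging to each coordinate.\<close>

definition tour_vector :: "('e::finite \<Rightarrow> nat \<times> nat) \<Rightarrow> (nat \<Rightarrow> nat) \<Rightarrow> real ^ 'e" where
  "tour_vector ends \<tau> = (\<chi> e. if \<tau> (fst (ends e)) = snd (ends e) then 1 else 0)"

definition PSB :: "nat \<Rightarrow> ('e::finite \<Rightarrow> nat \<times> nat) \<Rightarrow> (real ^ 'e) set" where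
  "PSB n ends = convex hull {tour_vector ends \<tau> | \<tau>. psb_tour n \<tau>}"

definition skeleton_verts :: "'a::euclidean_space set \<Rightarrow> 'a set" where
  "skeleton_verts P = {x. x extreme_point_of P}"

definition skeleton_edges :: "'a::euclidean_space set \<Rightarrow> 'a rel" where
  "skeleton_edges P = {(x, y). x \<in> skeleton_verts P \<and> y \<in> skeleton_verts P \<and> x \<noteq> y \<and>
     (\<exists>F. F edge_of P \<and> x \<in> F \<and> y \<in> F)}"

text \<open>The distance is the least length of a walk, and \<open>\<infinity>\<close> if there is none; hence a finite
  diameter entails connectedness.\<close>

definition edge_dist :: "'a rel \<Rightarrow> 'a \<Rightarrow> 'a \<Rightarrow> enat" where
  "edge_dist E x y = (INF k \<in> {k. (x, y) \<in> E ^^ k}. enat k)"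

definition skeleton_diameter :: "'a::euclidean_space set \<Rightarrow> enat" where
  "skeleton_diameter P =
     (SUP x \<in> skeleton_verts P. SUP y \<in> skeleton_verts P. edge_dist (skeleton_edges P) x y)"

end

theory Submission
  imports Defs
begin

text \<open>A pyramidal tour with step-backs climbs from \<open>1\<close> to \<open>n\<close> and then descends back to \<open>1\<close>;
  within either branch, disjoint pairs of consecutive cities \<open>i, i + 1\<close> may be visited in the wrong
  order. Given a tour \<open>y\<close>, let \<open>y'\<close> go from \<open>1\<close> directly to \<open>n\<close> and visit all other cities on the
  way down, inverting exactly those pairs that \<open>y\<close> inverts on its descending branch. The only
  tours using just arcs of \<open>y\<close> and \<open>y'\<close> are \<open>y\<close> and \<open>y'\<close>, which makes them adjacent: a coordinate
  hyperplane argument shows that they span a face. Reversing all tours, and since \<open>y'\<close> has no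
  ascending step-backs, \<open>y'\<close> is likewise adjacent to the tour \<open>c = (1, 2, \<dots>, n)\<close>. So any two
  tours are joined by the walk \<open>x, x', c, y', y\<close>.\<close>

section \<open>Tours as cyclic permutations, and their reversal\<close>

lemma cyclic_on_path:
  assumes "cyclic_on f S" "finite S" "s \<in> S"
  shows "inj_on (\<lambda>k. (f ^^ k) s) {..<card S}"
    and "(\<lambda>k. (f ^^ k) s) ` {..<card S} = S"
    and "(f ^^ card S) s = s"
proof -
  let ?N = "funpow_dist1 f s s"
  have S: "orbit f s = S" using assms by (simp add: orbit_cyclic_eq3)
  hence s: "s \<in> orbit f s" using assms by simp
  have inj: "inj_on (\<lambda>k. (f ^^ k) s) {..<?N}"
    using inj_on_funpow_dist1[OF s] by (simp add: atLeast0LessThan)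
  have img: "(\<lambda>k. (f ^^ k) s) ` {..<?N} = S"
    using orbit_conv_funpow_dist1[OF s] S by (simp add: atLeast0LessThan)
  have N: "?N = card S" using card_image[OF inj] img by simp
  show "inj_on (\<lambda>k. (f ^^ k) s) {..<card S}" using inj N by simp
  show "(\<lambda>k. (f ^^ k) s) ` {..<card S} = S" using img N by simp
  show "(f ^^ card S) s = s" using funpow_dist1_prop[OF s] N by simp
qed

lemma hamiltonian_tour_inv:
  assumes "hamiltonian_tour n y"
  shows "hamiltonian_tour n (inv y)"
proof -
  have y: "y permutes {1..n}" "cyclic_on y {1..n}"
    using assms by (auto simp: hamiltonian_tour_def)
  have "orbit (inv y) s = orbit y s" for s
    using y(1) by (intro orbit_inv_eq) (auto simp: permutation_permutes)
  thus ?thesis using y by (auto simp: hamiltonian_tour_def cyclic_on_def permutes_inv)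
qed

text \<open>Reversing the tour exchanges the two alternatives in
  \<open>step_back_peak\<close>.\<close>

lemma proper_peak_inv:
  assumes "bij y"
  shows "proper_peak (inv y) i \<longleftrightarrow> proper_peak y i"
  using assms by (auto simp: proper_peak_def peak_def step_back_peak_def inv_inv_eq)

lemma psb_tour_inv:
  assumes "psb_tour n y"
  shows "psb_tour n (inv y)"
proof -
  have "y permutes {1..n}" using assms by (auto simp: psb_tour_def hamiltonian_tour_def)
  thus ?thesis
    using assms by (simp add: psb_tour_def hamiltonian_tour_inv proper_peak_inv permutes_bij)
qed

section \<open>Step-back pairs and the canonical descending tours\<close>

text \<open>The lower cities of the step-back pairs on the descending branch. Applied to \<open>inv y\<close>
  it yields those of the ascending branch of \<open>y\<close>.\<close>

definition drops :: "(nat \<Rightarrow> nat) \<Rightarrow> nat set" where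
  "drops y = {i. y i = Suc i \<and> y (Suc i) < i \<and> Suc i < inv y i}"

text \<open>The pairs \<open>i, i + 1\<close> with \<open>i \<in> B\<close> are then disjoint and
  avoid the cities \<open>1\<close> and \<open>n\<close>, which makes \<open>swp B\<close> an
  involution fixing both of these.\<close>

definition block_set :: "nat \<Rightarrow> nat set \<Rightarrow> bool" where
  "block_set n B \<longleftrightarrow> (\<forall>i\<in>B. 2 \<le> i \<and> Suc i < n \<and> Suc i \<notin> B)"

definition swp :: "nat set \<Rightarrow> nat \<Rightarrow> nat" where
  "swp B i = (if i \<in> B then Suc i else if i \<in> Suc ` B then i - 1 else i)"

definition rot :: "nat \<Rightarrow> nat \<Rightarrow> nat" where
  "rot n i = (if i = 1 then n else if i \<in> {2..n} then i - 1 else i)"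

text \<open>Renaming the cities of the tour \<open>(n, n - 1, \<dots>, 1)\<close> by the involution \<^term>\<open>swp B\<close> inverts
  precisely the pairs \<open>i, i + 1\<close> with \<open>i \<in> B\<close>.\<close>

definition descend :: "nat \<Rightarrow> nat set \<Rightarrow> nat \<Rightarrow> nat" where
  "descend n B = swp B \<circ> rot n \<circ> swp B"

lemma swp_swp: "block_set n B \<Longrightarrow> swp B (swp B i) = i"
  by (auto simp: swp_def block_set_def)

lemma swp_range: "block_set n B \<Longrightarrow> i \<in> {1..n} \<Longrightarrow> swp B i \<in> {1..n}"
  by (force simp: swp_def block_set_def)

lemma swp_fix:
  assumes "block_set n B"
  shows "i \<le> 1 \<Longrightarrow> swp B i = i" and "n \<le> i \<Longrightarrow> swp B i = i"
  using assms by (fastforce simp: swp_def block_set_def)+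

lemma swp_permutes:
  assumes "block_set n B"
  shows "swp B permutes {1..n}"
proof (rule bij_imp_permutes)
  show "bij_betw (swp B) {1..n} {1..n}"
    by (rule bij_betw_byWitness[where f' = "swp B"])
      (use swp_swp[OF assms] swp_range[OF assms] in auto)
  show "swp B x = x" if "x \<notin> {1..n}" for x
    using that swp_fix[OF assms, of x] by (cases "x = 0") auto
qed

lemma rot_permutes: "1 \<le> n \<Longrightarrow> rot n permutes {1..n}"
  by (rule bij_imp_permutes,
      rule bij_betw_byWitness[where f' = "\<lambda>i. if i = n then 1 else Suc i"])
    (auto simp: rot_def)

lemma rot_cyclic: assumes "1 \<le> n" shows "cyclic_on (rot n) {1..n}"
proof -
  have pow: "(rot n ^^ Suc k) 1 = n - k" if "k < n" for k
    using that by (induction k) (auto simp: rot_def)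
  have "{1..n} \<subseteq> orbit (rot n) 1"
  proof
    fix i assume "i \<in> {1..n}"
    hence "(rot n ^^ Suc (n - i)) 1 = i" using pow[of "n - i"] by auto
    thus "i \<in> orbit (rot n) 1" unfolding orbit_altdef by (metis (mono_tags, lifting) mem_Collect_eq zero_less_Suc)
  qed
  moreover have "orbit (rot n) 1 \<subseteq> {1..n}"
    using rot_permutes[OF assms] assms by (intro permutes_orbit_subset) auto
  ultimately show ?thesis using assms unfolding cyclic_on_def by force
qed

text \<open>As \<open>swp B\<close> is its own inverse, \<open>descend n B\<close> is a conjugate of
  the \<open>n\<close>-cycle \<open>rot n\<close>.\<close>

lemma hamiltonian_tour_descend:
  assumes "1 \<le> n" "block_set n B"
  shows "hamiltonian_tour n (descend n B)"
proof -
  have "cyclic_on (descend n B) (swp B ` {1..n})"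
    using rot_cyclic[OF assms(1)]
    by (rule cyclic_on_image) (simp add: descend_def swp_swp[OF assms(2)])
  moreover have "swp B ` {1..n} = {1..n}"
    using swp_permutes[OF assms(2)] by (rule permutes_image)
  ultimately show ?thesis
    unfolding hamiltonian_tour_def
    using permutes_compose[OF swp_permutes permutes_compose[OF rot_permutes swp_permutes]] assms
    by (simp add: descend_def comp_assoc)
qed

lemma descend_one: "block_set n B \<Longrightarrow> descend n B 1 = n"
  by (simp add: descend_def swp_fix rot_def)

lemma descend_block:
  assumes "block_set n B" "i \<in> B"
  shows "descend n B i = Suc i"
  using assms by (fastforce simp: descend_def swp_def rot_def block_set_def)

text \<open>With \<open>descend_one\<close> and \<open>descend_block\<close> this locates all upward
  arcs: they leave \<open>1\<close> or the lower city of a pair.\<close>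

lemma descend_less:
  assumes "block_set n B" "2 \<le> i" "i \<le> n" "i \<notin> B"
  shows "descend n B i < i"
proof (cases "i \<in> Suc ` B")
  case True
  then obtain j where "j \<in> B" "i = Suc j" by blast
  then show ?thesis using assms by (force simp: descend_def swp_def rot_def block_set_def)
next
  case False
  hence "swp B i = i" "i - 1 \<notin> B"
    using assms by (auto simp: swp_def image_iff)
  then show ?thesis using assms by (auto simp: descend_def swp_def rot_def)
qed

text \<open>A peak other than \<open>n\<close> is entered by an upward arc that does not leave
  \<open>1\<close>, so it is the upper city of an inverted pair. The tour comes to that pair from
  above, which yields a step-back peak of the second kind.\<close>

lemma psb_tour_descend:
  assumes "3 \<le> n" "block_set n B"
  shows "psb_tour n (descend n B)"
proof -
  let ?f = "descend n B"
  have ham: "hamiltonian_tour n ?f"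
    using hamiltonian_tour_descend assms by simp
  hence perm: "?f permutes {1..n}" by (simp add: hamiltonian_tour_def)
  have inv: "inv ?f (?f i) = i" "?f (inv ?f i) = i" for i
    using perm by (simp_all add: permutes_inverses)
  have range: "?f i \<in> {1..n}" "inv ?f i \<in> {1..n}" if "i \<in> {1..n}" for i
    using that permutes_in_image[OF perm] permutes_in_image[OF permutes_inv[OF perm]] by blast+
  have one: "?f 1 = n" by (rule descend_one) fact
  have n: "proper_peak ?f n"
  proof -
    have "n \<notin> B" using assms(2) by (auto simp: block_set_def)
    hence "?f n < n" using descend_less assms by simp
    moreover have "inv ?f n = 1" using inv one by metis
    moreover have "?f (?f n) \<le> n" using range[of n] range[of "?f n"] assms(1) by simp
    ultimately show ?thesis
      using assms(1) by (auto simp: proper_peak_def peak_def step_back_peak_def)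
  qed
  have "i = n" if i: "i \<in> {1..n}" "proper_peak ?f i" for i
  proof (rule ccontr)
    assume "i \<noteq> n"
    define j where "j = inv ?f i"
    have j: "?f j = i" "j < i" "?f i < i"
      using i inv by (auto simp: j_def proper_peak_def peak_def)
    have j1: "j \<in> {1..n}" using range i by (simp add: j_def)
    have j2: "j \<noteq> 1" using one j \<open>i \<noteq> n\<close> by auto
    have jB: "j \<in> B" using descend_less[OF assms(2), of j] j j1 j2 by fastforce
    have ij: "i = Suc j" using descend_block[OF assms(2) jB] j by simp
    define v where "v = inv ?f j"
    have v: "?f v = j" "v \<in> {1..n}" using inv range j1 by (auto simp: v_def)
    have B: "Suc b \<notin> B" "Suc b < n" "2 \<le> b" if "b \<in> B" for b
      using that assms(2) by (auto simp: block_set_def)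
    have "v \<noteq> 1" using v one B[OF jB] by auto
    have vinv: "inv ?f (inv ?f i) = v" by (simp add: v_def j_def)
    have "v \<notin> B" using descend_block[OF assms(2)] B v jB by force
    hence "j < v" using descend_less[OF assms(2), of v] v \<open>v \<noteq> 1\<close> by force
    \<comment> \<open>Otherwise \<open>j\<close> and \<open>i = Suc j\<close> would form a
      two-cycle; undoing \<open>swp\<close> would give \<open>rot n j = Suc j\<close>, although
      \<open>rot\<close> lowers \<open>j\<close>.\<close>
    moreover have "v \<noteq> i"
    proof
      assume "v = i"
      hence "swp B (rot n j) = j"
        using v ij jB B[OF jB] by (simp add: descend_def swp_def image_iff)
      hence "rot n j = swp B j" using swp_swp[OF assms(2)] by metis
      thus False using jB j1 j2 by (auto simp: swp_def rot_def)
    qed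
    ultimately have "inv ?f (inv ?f i) > i" using ij vinv by simp
    moreover have "inv ?f i = i - 1" using ij j_def by simp
    ultimately have "step_back_peak ?f i" using j(3) unfolding step_back_peak_def by blast
    thus False using i by (simp add: proper_peak_def)
  qed
  hence "{i \<in> {1..n}. proper_peak ?f i} = {n}" using n assms(1) by auto
  thus ?thesis using ham by (simp add: psb_tour_def)
qed

lemma strict_mono_upto_add_le:
  fixes f :: "nat \<Rightarrow> nat"
  assumes "\<And>k. k < m \<Longrightarrow> f k < f (Suc k)" "i \<le> m"
  shows "f i + (m - i) \<le> f m"
  using assms(2,1)
proof (induction rule: dec_induct)
  case (step k)
  have "f i + (k - i) \<le> f k" using step by simp
  moreover have "f k < f (Suc k)" using step by simp
  ultimately show ?case using \<open>i \<le> k\<close> by arith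
qed simp

section \<open>The path of a tour from city \<open>1\<close> and its ascending branch\<close>

locale psb_path =
  fixes n :: nat and y :: "nat \<Rightarrow> nat"
  assumes n3: "3 \<le> n" and psb: "psb_tour n y"
begin

definition p :: "nat \<Rightarrow> nat" where "p k = (y ^^ k) 1"

lemma perm: "y permutes {1..n}" and cyc: "cyclic_on y {1..n}"
  using psb by (auto simp: psb_tour_def hamiltonian_tour_def)

lemma inv_y [simp]: "inv y (y i) = i" "y (inv y i) = i"
  using perm by (simp_all add: permutes_inverses)

lemma y_eq_iff [simp]: "y i = y j \<longleftrightarrow> i = j"
  by (metis inv_y(1))

lemma p_0 [simp]: "p 0 = 1" and p_Suc: "p (Suc k) = y (p k)"
  by (simp_all add: p_def)

lemma p_inj: "i < n \<Longrightarrow> j < n \<Longrightarrow> p i = p j \<longleftrightarrow> i = j"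
  and p_surj: "i \<in> {1..n} \<Longrightarrow> \<exists>k<n. p k = i"
  and p_n: "p n = 1"
  and p_range: "k < n \<Longrightarrow> p k \<in> {1..n}"
proof -
  have inj: "inj_on p {..<n}" and img: "p ` {..<n} = {1..n}" and "p n = 1"
    using cyclic_on_path[OF cyc, of 1] n3 unfolding p_def by simp_all
  show "i < n \<Longrightarrow> j < n \<Longrightarrow> p i = p j \<longleftrightarrow> i = j" using inj by (auto simp: inj_on_eq_iff)
  show "\<exists>k<n. p k = i" if "i \<in> {1..n}"
    using that unfolding img[symmetric] by auto
  show "p n = 1" by fact
  show "p k \<in> {1..n}" if "k < n" using that unfolding img[symmetric] by auto
qed

lemma inv_p: "inv y (p (Suc k)) = p k"
  by (simp add: p_Suc)

lemma y_range: "i \<in> {1..n} \<Longrightarrow> y i \<in> {1..n}"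
  using permutes_in_image[OF perm] by blast

lemma y_neq: assumes "i \<in> {1..n}" shows "y i \<noteq> i"
proof
  assume *: "y i = i"
  obtain k where k: "k < n" "p k = i" using p_surj assms by blast
  show False
  proof (cases "Suc k < n")
    case True
    then show ?thesis using p_inj[of "Suc k" k] k * by (simp add: p_Suc)
  next
    case False
    hence "Suc k = n" using k by simp
    hence "i = 1" using p_n p_Suc[of k] k * by metis
    then show ?thesis using p_inj[of k 0] k \<open>Suc k = n\<close> n3 by auto
  qed
qed

lemma step_back:
  assumes "i \<in> {1..n}" "i \<noteq> n" "inv y i < i" "y i < i"
  shows "step_back_peak y i"
proof (rule ccontr)
  assume "\<not> step_back_peak y i"
  hence "i \<in> {i \<in> {1..n}. proper_peak y i}"
    using assms by (simp add: proper_peak_def peak_def)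
  moreover have "{i \<in> {1..n}. proper_peak y i} = {n}" using psb by (simp add: psb_tour_def)
  ultimately show False using assms(2) by blast
qed

text \<open>The ascending branch is \<open>p 0, \<dots>, p M\<close>. The descending one is the ascending branch of
  \<open>inv y\<close>, so every fact about the former is available for the latter.\<close>

definition M :: nat where "M = (SOME k. k < n \<and> p k = n)"

lemma M: "M < n" "p M = n"
  using someI_ex[OF p_surj[of n, simplified]] n3 unfolding M_def[symmetric] by auto

lemma p_less_n: "k < n \<Longrightarrow> k \<noteq> M \<Longrightarrow> p k < n"
  using p_inj[of k M] M p_range[of k] by force

lemma p_gt_1: "k < n \<Longrightarrow> k \<noteq> 0 \<Longrightarrow> 1 < p k"
  using p_inj[of k 0] p_range[of k] by force

text \<open>Up to \<open>n\<close> the path from \<open>1\<close> only visits new maxima, except when a step-back makes it drop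
  to the city right below the current maximum.\<close>

lemma climb:
  assumes "k \<le> M"
  shows "(\<forall>j<k. p j < p k) \<or>
    (\<exists>l. k = Suc l \<and> 1 \<le> l \<and> k < M \<and> p l = Suc (p k) \<and> p l < p (Suc k) \<and> (\<forall>j<l. p j < p k))"
    (is "?R k \<or> ?D k")
  using assms
proof (induction k)
  case 0
  then show ?case by simp
next
  case (Suc k)
  have kn: "Suc k < n" using Suc M by simp
  from Suc consider "?R k" | "?D k" by auto
  then show ?case
  proof cases
    case 1
    show ?thesis
    proof (cases "p k < p (Suc k)")
      case True
      then show ?thesis using 1 by (auto simp: less_Suc_eq)
    next
      case False
      hence lt: "p (Suc k) < p k" using p_inj[of k "Suc k"] kn by force
      hence k0: "k \<noteq> 0" using p_range[of "Suc k"] kn by (auto intro: ccontr)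
      then obtain m where m: "k = Suc m" by (cases k) auto
      have "step_back_peak y (p k)"
        using p_range[of k] p_less_n[of k] kn Suc.prems lt 1 inv_p[of m]
        by (intro step_back) (auto simp: m p_Suc)
      \<comment> \<open>This excludes the second kind of step-back peak. The city two places before
        \<open>p k\<close> is bounded by \<open>?R k\<close>, unless \<open>m = 0\<close>, where it
        lies at the far end of the path; then \<open>p k = 2\<close>, and a descent would return to
        \<open>1\<close> too early.\<close>
      moreover have "\<not> inv y (p m) > p k" if "inv y (p k) = p k - 1" "y (p k) < p k"
      proof (cases m)
        case 0
        have "p k = 2" using that inv_p[of m] m 0 p_gt_1[of k] kn by auto
        hence "p (Suc k) = 1" using lt p_range[of "Suc k"] kn by auto
        thus ?thesis using p_gt_1[of "Suc k"] kn by simp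
      next
        case (Suc q)
        then show ?thesis using inv_p[of q] 1 m by (metis Suc_lessD less_not_sym lessI)
      qed
      ultimately have 2: "p (Suc k) = p k - 1" "p k < p (Suc (Suc k))"
        using m by (auto simp: step_back_peak_def p_Suc inv_p)
      have "p j < p (Suc k)" if "j < k" for j
        using 1 that 2 p_inj[of j "Suc k"] kn by fastforce
      moreover have "Suc k < M" using Suc.prems lt p_range[of k] kn M
        by (cases "Suc k = M") auto
      ultimately show ?thesis using 2 k0 lt by (intro disjI2 exI[of _ k]) auto
    qed
  next
    case 2
    then obtain l where l: "k = Suc l" "p l = Suc (p k)" "p l < p (Suc k)" "\<forall>j<l. p j < p k"
      by blast
    hence "?R (Suc k)" by (fastforce simp: less_Suc_eq)
    thus ?thesis ..
  qed
qed

text \<open>\<open>climb\<close> read for a single arc: a descent is the inner arc of a step-back,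
  so both neighbouring arcs are controlled as well.\<close>

lemma climb_step:
  assumes "k < M"
  shows "p k < p (Suc k) \<or>
    (\<exists>l. k = Suc l \<and> Suc k < M \<and> p k = Suc (p (Suc k)) \<and> p k < p (Suc (Suc k)) \<and> p l < p (Suc k))"
proof -
  have "Suc k \<le> M" using assms by simp
  from climb[OF this] show ?thesis by (cases k) auto
qed

lemma climb_later:
  assumes "Suc k < j" "j \<le> M"
  shows "p k < p j"
  using climb[OF assms(2)] assms(1) by auto

lemma climb_drop_le:
  assumes "k < M"
  shows "p k \<le> Suc (p (Suc k))"
  using climb_step[OF assms] by auto

lemma psb_path_inv: "psb_path n (inv y)"
  using n3 psb by unfold_locales (auto intro: psb_tour_inv)

section \<open>Step-back pairs of either branch\<close>

lemma block_set_drops: "block_set n (drops y)"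
  unfolding block_set_def
proof (intro ballI conjI)
  fix i assume "i \<in> drops y"
  hence i: "y i = Suc i" "y (Suc i) < i" "Suc i < inv y i" by (auto simp: drops_def)
  have "i \<in> {1..n}" using i(1) perm by (metis permutes_not_in n_not_Suc_n)
  hence "inv y i \<in> {1..n}" "Suc i \<in> {1..n}"
    using y_range[of i] i(1) permutes_inv[OF perm] permutes_in_image by metis+
  thus "Suc i < n" "2 \<le> i" using i y_range[of "Suc i"] by auto
  show "Suc i \<notin> drops y" using i by (auto simp: drops_def)
qed

text \<open>A city in \<open>drops y\<close> is entered from more than one above, whereas the
  ascending branch never falls by more than one. The upper city of a pair is entered from the lower
  one, which reduces it to the first case.\<close>

lemma climb_not_drop:
  assumes "k \<le> M"
  shows "p k \<notin> drops y" "p k \<notin> Suc ` drops y"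
proof -
  have *: "p k \<notin> drops y" if k: "k \<le> M" for k
  proof
    assume d: "p k \<in> drops y"
    show False
    proof (cases k)
      case 0
      then show ?thesis using d block_set_drops by (auto simp: block_set_def)
    next
      case (Suc j)
      then show ?thesis using d climb_drop_le[of j] k inv_p[of j] by (auto simp: drops_def)
    qed
  qed
  show "p k \<notin> drops y" by (rule *) fact
  show "p k \<notin> Suc ` drops y"
  proof
    assume "p k \<in> Suc ` drops y"
    then obtain i where i: "i \<in> drops y" "p k = Suc i" by blast
    have "2 \<le> i" using i(1) block_set_drops by (auto simp: block_set_def)
    hence "k \<noteq> 0" using i(2) by (cases "k = 0") auto
    then obtain j where j: "k = Suc j" by (cases k) auto
    have "y i = Suc i" using i by (simp add: drops_def)
    hence "p j = i" using i(2) j y_eq_iff by (metis p_Suc)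
    thus False using *[of j] i assms j by auto
  qed
qed

lemma inv_inv_y [simp]: "inv (inv y) = y"
  using perm by (simp add: permutes_bij inv_inv_eq)

lemma block_set_drops_inv: "block_set n (drops (inv y))"
  by (rule psb_path.block_set_drops[OF psb_path_inv])

text \<open>\<open>climb_step\<close> supplies the two arcs around a descent that membership in
  \<open>drops\<close> asks for.\<close>

lemma drop_iff:
  assumes "k < M"
  shows "p (Suc k) < p k \<longleftrightarrow> p (Suc k) \<in> drops (inv y)"
proof
  assume "p (Suc k) < p k"
  then obtain l where "k = Suc l" "p k = Suc (p (Suc k))" "p k < p (Suc (Suc k))" "p l < p (Suc k)"
    using climb_step[OF assms] by auto
  then show "p (Suc k) \<in> drops (inv y)"
    using inv_p[of k] inv_p[of l] p_Suc[of "Suc k"] by (auto simp: drops_def)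
next
  assume "p (Suc k) \<in> drops (inv y)"
  then show "p (Suc k) < p k" using inv_p[of k] by (auto simp: drops_def)
qed

lemma swp_p_drop:
  assumes "k < M" "p (Suc k) < p k"
  shows "swp (drops (inv y)) (p k) = p (Suc k)" "swp (drops (inv y)) (p (Suc k)) = p k"
proof -
  have d: "p (Suc k) \<in> drops (inv y)" using drop_iff assms by blast
  moreover have "p k = Suc (p (Suc k))" using climb_step assms by force
  ultimately show "swp (drops (inv y)) (p (Suc k)) = p k" by (simp add: swp_def)
  thus "swp (drops (inv y)) (p k) = p (Suc k)"
    by (metis swp_swp block_set_drops_inv)
qed

lemma swp_p_no_drop:
  assumes "k \<le> M" "k < M \<Longrightarrow> p k < p (Suc k)" "\<And>l. k = Suc l \<Longrightarrow> p l < p k"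
  shows "swp (drops (inv y)) (p k) = p k"
proof -
  have "p k \<notin> drops (inv y)"
  proof (cases k)
    case 0
    then show ?thesis using block_set_drops_inv by (auto simp: block_set_def)
  next
    case (Suc l)
    then show ?thesis using drop_iff[of l] assms by auto
  qed
  moreover have "p k \<noteq> Suc i" if i: "i \<in> drops (inv y)" for i
  proof
    assume *: "p k = Suc i"
    hence "k \<noteq> M" using M i block_set_drops_inv by (force simp: block_set_def)
    hence "k < M" using assms by simp
    moreover have "p (Suc k) = i" using i * inv_y(2)[of i] by (simp add: drops_def p_Suc)
    ultimately show False using assms(2) * by simp
  qed
  ultimately show ?thesis by (auto simp: swp_def)
qed

text \<open>Applying \<open>swp\<close> undoes the step-backs and so straightens the ascending
  branch into an increasing sequence. An upward arc may leave the end of one step-back and enter the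
  start of another, so \<open>swp\<close> has to be traced at both ends.\<close>

lemma swp_p_step:
  assumes "k < M"
  shows "swp (drops (inv y)) (p k) < swp (drops (inv y)) (p (Suc k))"
proof (cases "p (Suc k) < p k")
  case True
  then show ?thesis using swp_p_drop assms by simp
next
  case False
  have kn: "Suc k < n" using assms M by simp
  hence up: "p k < p (Suc k)" using False p_inj[of k "Suc k"] by (metis Suc_lessD linorder_neqE_nat n_not_Suc_n)
  define r where "r = swp (drops (inv y)) (p (Suc k))"
  \<comment> \<open>The position of \<open>r\<close> after \<open>k\<close> is recorded to separate
    \<open>r\<close> from \<open>p l = Suc (p k)\<close> when a step-back ends at
    \<open>k\<close>.\<close>
  have r: "p k < r \<and> (\<exists>j. k < j \<and> j < n \<and> r = p j)"
  proof (cases "Suc k < M \<and> p (Suc (Suc k)) < p (Suc k)")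
    case True
    then have "r = p (Suc (Suc k))" using swp_p_drop[of "Suc k"] by (simp add: r_def)
    moreover have "p k < p (Suc (Suc k))" using climb_step[of "Suc k"] True by auto
    ultimately show ?thesis using True M by (auto intro!: exI[of _ "Suc (Suc k)"])
  next
    case False
    have "r = p (Suc k)" unfolding r_def
    proof (rule swp_p_no_drop)
      show "p (Suc k) < p (Suc (Suc k))" if "Suc k < M"
        using climb_step[of "Suc k"] that False by auto
    qed (use assms up in auto)
    then show ?thesis using up kn by auto
  qed
  have "swp (drops (inv y)) (p k) < r"
  proof (cases "\<exists>l. k = Suc l \<and> p k < p l")
    case True
    then obtain l where l: "k = Suc l" "p k < p l" by blast
    hence "p l = Suc (p k)" using climb_step[of l] assms by auto
    moreover have "swp (drops (inv y)) (p k) = p l" using swp_p_drop(2)[of l] l assms by simp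
    moreover have "r \<noteq> p l" using r p_inj l by (metis lessI less_trans not_less_iff_gr_or_eq)
    ultimately show ?thesis using r by linarith
  next
    case False
    have "swp (drops (inv y)) (p k) = p k"
    proof (rule swp_p_no_drop)
      show "p l < p k" if "k = Suc l" for l
        using False that p_inj[of l k] kn by (metis Suc_lessD lessI linorder_neqE_nat less_irrefl)
    qed (use assms up in auto)
    then show ?thesis using r by simp
  qed
  thus ?thesis by (simp add: r_def)
qed

lemma swp_p_mono:
  assumes "i < j" "j \<le> M"
  shows "swp (drops (inv y)) (p i) < swp (drops (inv y)) (p j)"
  using assms
proof (induction j)
  case (Suc j)
  then show ?case using swp_p_step[of j] by (cases "i = j") auto
qed simp

section \<open>The descending branch as the ascending branch of the reversed tour\<close>

lemma path_inv:
  assumes "k \<le> n"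
  shows "psb_path.p (inv y) k = p (n - k)"
  using assms
proof (induction k)
  case 0
  then show ?case using psb_path.p_0[OF psb_path_inv] p_n by simp
next
  case (Suc k)
  then have "n - k = Suc (n - Suc k)" by simp
  then show ?case using Suc psb_path.p_Suc[OF psb_path_inv, of k] inv_p by simp
qed

lemma M_pos: "M \<noteq> 0"
  using M n3 p_0 by (metis numeral_le_one_iff semiring_norm(70))

lemma M_inv: "psb_path.M n (inv y) = n - M"
proof -
  interpret W: psb_path n "inv y" by (rule psb_path_inv)
  have "W.p (n - M) = n" using path_inv[of "n - M"] M by simp
  moreover have "n - M < n" using M_pos M by simp
  ultimately show ?thesis using W.p_inj[OF W.M(1)] W.M(2) by metis
qed

text \<open>Being entered from more than one above puts \<open>i\<close> on the descending branch.
  There \<open>climb_step\<close> for \<open>inv y\<close> supplies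
  \<open>y (Suc i) < i\<close>.\<close>

lemma drops_if_valley:
  assumes "2 \<le> i" "y i = Suc i" "Suc i < inv y i"
  shows "i \<in> drops y"
proof -
  interpret W: psb_path n "inv y" by (rule psb_path_inv)
  have "i \<in> {1..n}" using assms(2) perm by (metis permutes_not_in n_not_Suc_n)
  then obtain j where j: "j < n" "p j = i" using p_surj by blast
  show ?thesis
  proof (cases "j \<le> M")
    case True
    obtain l where l: "j = Suc l" using j assms(1) by (cases j) auto
    show ?thesis using climb_drop_le[of l] inv_p[of l] l j True assms(3) by auto
  next
    case False
    \<comment> \<open>On the reversed path \<open>i\<close> has position
      \<open>n - j = Suc l\<close>.\<close>
    define l where "l = n - Suc j"
    have l: "W.p (Suc l) = i" "l < W.M"
      using path_inv[of "Suc l"] j False M_inv by (auto simp: l_def Suc_diff_Suc)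
    have "W.p l = Suc i" using W.inv_p[of l] l assms(2) by simp
    then obtain m where m: "l = Suc m" "W.p m < i"
      using W.climb_step[OF l(2)] l(1) by auto
    moreover have "W.p m = y (Suc i)"
      using W.inv_p[of m] m \<open>W.p l = Suc i\<close> by simp
    ultimately show ?thesis using assms by (simp add: drops_def)
  qed
qed

text \<open>Straightened by \<open>swp\<close>, the descending branch is strictly decreasing, while
  \<open>rot\<close> lowers by exactly one. Hence no city of the branch fits between the ends of an
  arc of \<open>descend\<close>.\<close>

lemma descend_later:
  assumes "M \<le> k" "k < j" "j < n" "descend n (drops y) (p k) = p j"
  shows "j = Suc k"
proof (rule ccontr)
  assume "j \<noteq> Suc k"
  interpret W: psb_path n "inv y" by (rule psb_path_inv)
  define h where "h = (\<lambda>l. swp (drops y) (W.p l))"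
  have mono: "h a < h b" if "a < b" "b \<le> n - M" for a b
    using W.swp_p_mono[of a b] that M_inv by (simp add: h_def)
  have B: "block_set n (drops y)" by (rule block_set_drops)
  have hk: "swp (drops y) (p k) = h (n - k)" and hj: "swp (drops y) (p j) = h (n - j)"
    using path_inv[of "n - k"] path_inv[of "n - j"] assms by (simp_all add: h_def)
  have "h 0 = 1" using swp_fix[OF B] by (simp add: h_def)
  hence "1 < h (n - k)" using mono[of 0 "n - k"] assms by simp
  moreover have "h (n - k) \<le> n"
    unfolding hk[symmetric] using swp_range[OF B p_range[of k]] assms by simp
  ultimately have "rot n (h (n - k)) = h (n - k) - 1" by (simp add: rot_def)
  moreover have "rot n (h (n - k)) = h (n - j)"
    using assms(4) hk hj swp_swp[OF B] by (metis comp_apply descend_def)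
  moreover have "h (n - j) < h (n - Suc k)" "h (n - Suc k) < h (n - k)"
    using assms \<open>j \<noteq> Suc k\<close> by (auto intro!: mono)
  ultimately show False by simp
qed

text \<open>Here the descending branch contains every city except \<open>1\<close> at its end. Its
  straightening lists all cities in order, so conjugating \<open>y\<close> by \<open>swp\<close>
  gives \<open>rot n\<close>.\<close>

lemma descend_if_one:
  assumes "y 1 = n"
  shows "y = descend n (drops y)"
proof
  fix i
  interpret W: psb_path n "inv y" by (rule psb_path_inv)
  have B: "block_set n (drops y)" by (rule block_set_drops)
  define h where "h = (\<lambda>l. swp (drops y) (W.p l))"
  have "p 1 = n" using assms p_Suc[of 0] by simp
  hence "M = 1" using p_inj[OF M(1), of 1] M(2) n3 by simp
  hence WM: "W.M = n - 1" using M_inv by simp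
  have step: "h k < h (Suc k)" if "k < n - 1" for k
    using W.swp_p_step[of k] that WM by (simp add: h_def)
  have h: "h k = Suc k" if "k < n" for k
  proof -
    \<comment> \<open>The \<open>n\<close> strictly increasing values start at \<open>1\<close> and
      stay at most \<open>n\<close>, so each is squeezed to \<open>Suc k\<close>.\<close>
    have "h 0 + (k - 0) \<le> h k" "h k + (n - 1 - k) \<le> h (n - 1)"
      using that strict_mono_upto_add_le[of k h 0] strict_mono_upto_add_le[of "n - 1" h k] step
      by auto
    moreover have "h 0 = 1" using swp_fix[OF B] by (simp add: h_def)
    moreover have "h (n - 1) \<le> n"
      using swp_range[OF B W.p_range[of "n - 1"]] n3 by (simp add: h_def)
    ultimately show ?thesis using that by simp
  qed
  show "y i = descend n (drops y) i"
  proof (cases "i \<in> {1..n}")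
    case True
    then obtain k where k: "k < n" "W.p k = i" using W.p_surj by blast
    show ?thesis
    proof (cases k)
      case 0
      then show ?thesis using k assms descend_one[OF B] by simp
    next
      case (Suc l)
      have "y i = W.p l" using W.inv_p[of l] Suc k by simp
      also have "\<dots> = swp (drops y) (h l)" by (simp add: h_def swp_swp[OF B])
      also have "h l = rot n (h k)" using h[of l] h[of k] Suc k by (simp add: rot_def)
      finally show ?thesis using k by (simp add: h_def descend_def)
    qed
  next
    case False
    have "descend n (drops y) permutes {1..n}"
      using hamiltonian_tour_descend[OF _ B] n3 by (simp add: hamiltonian_tour_def)
    then show ?thesis using permutes_not_in[OF _ False] perm by metis
  qed
qed

end

section \<open>Tours inside the union of \<open>y\<close> and its companion
  \<open>descend n (drops y)\<close>\<close>

text \<open>By \<open>descend_if_one\<close> such a tour is determined by its step-back pairs, so it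
  suffices to compare \<open>drops z\<close> with \<open>drops y\<close>.\<close>

lemma union_descend_first:
  assumes n3: "3 \<le> n" and y: "psb_tour n y" and z: "psb_tour n z"
    and sub: "\<And>i. z i = y i \<or> z i = descend n (drops y) i"
    and one: "z 1 = n"
  shows "z = descend n (drops y)"
proof -
  interpret Y: psb_path n y by unfold_locales fact+
  interpret Z: psb_path n z by unfold_locales fact+
  let ?Y = "descend n (drops y)"
  have B: "block_set n (drops y)" by (rule Y.block_set_drops)
  have Z: "z = descend n (drops z)" by (rule Z.descend_if_one) fact
  have "drops z \<subseteq> drops y"
  proof
    fix i assume i: "i \<in> drops z"
    hence zi: "z i = Suc i" "z (Suc i) < i" "Suc i < inv z i" by (auto simp: drops_def)
    have i2: "2 \<le> i" "Suc i < n" using i Z.block_set_drops by (auto simp: block_set_def)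
    show "i \<in> drops y"
    proof (rule ccontr)
      assume ni: "i \<notin> drops y"
      hence "?Y i < i" using descend_less[OF B] i2 by simp
      hence yi: "y i = Suc i" using sub[of i] zi by auto
      define v where "v = inv z i"
      have v: "z v = i" "Suc i < v" using zi by (auto simp: v_def)
      have "v \<in> {1..n}" using Z.psb_path_inv[THEN psb_path.y_range, of i] i2 by (simp add: v_def)
      have "y v = i \<or> ?Y v = i" using sub[of v] v(1) by metis
      thus False
      proof
        assume "y v = i"
        hence "Suc i < inv y i" using v by auto
        thus False using Y.drops_if_valley[OF i2(1) yi] ni by simp
      next
        assume "?Y v = i"
        hence eq: "rot n (swp (drops y) v) = swp (drops y) i"
          using swp_swp[OF B] by (metis comp_apply descend_def)
        \<comment> \<open>Hence \<open>swp\<close> does not move \<open>Suc (Suc i)\<close> down, so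
          \<open>swp (drops y) v\<close> is at least \<open>i + 2\<close> and \<open>rot\<close>
          takes it above \<open>swp (drops y) i\<close>.\<close>
        have Si: "Suc i \<notin> drops y"
        proof
          assume "Suc i \<in> drops y"
          hence "Suc (Suc i) < inv y (y i)" using yi by (simp add: drops_def)
          thus False by simp
        qed
        have "swp (drops y) v \<in> {1..n}" using swp_range[OF B] \<open>v \<in> {1..n}\<close> .
        moreover have "Suc (Suc i) \<le> swp (drops y) v"
          using Si v(2) by (cases "v = Suc (Suc i)") (auto simp: swp_def)
        moreover have "swp (drops y) i \<le> i" using ni by (auto simp: swp_def)
        ultimately show False using eq v(2) i2 by (auto simp: rot_def split: if_splits)
      qed
    qed
  qed
  moreover have "drops y \<subseteq> drops z"
  proof
    fix i assume i: "i \<in> drops y"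
    hence "y i = Suc i" "?Y i = Suc i" using descend_block[OF B] by (auto simp: drops_def)
    hence "z i = Suc i" using sub[of i] by auto
    moreover have "2 \<le> i" "i \<le> n" using i B by (auto simp: block_set_def)
    ultimately show "i \<in> drops z"
      using descend_less[OF Z.block_set_drops, of i] Z by (metis Suc_n_not_le_n less_or_eq_imp_le)
  qed
  ultimately show ?thesis using Z by simp
qed

text \<open>At the first place on the path of \<open>y\<close> where \<open>z\<close> deviates,
  \<open>z\<close> takes an arc of the companion. On the ascending branch this starts a step-back of
  \<open>z\<close> that \<open>y\<close> cannot complete; on the descending branch
  \<open>descend_later\<close> forces the arc of \<open>y\<close> itself.\<close>

lemma union_descend_agree:
  assumes n3: "3 \<le> n" and y: "psb_tour n y" and z: "psb_tour n z"
    and sub: "\<And>i. z i = y i \<or> z i = descend n (drops y) i"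
    and one: "z 1 \<noteq> n"
  shows "z = y"
proof -
  interpret Y: psb_path n y by unfold_locales fact+
  interpret Z: psb_path n z by unfold_locales fact+
  interpret W: psb_path n "inv y" by (rule Y.psb_path_inv)
  let ?Y = "descend n (drops y)"
  have B: "block_set n (drops y)" by (rule Y.block_set_drops)
  have agree: "z (Y.p k) = y (Y.p k)" if "k < n" for k
    using that
  proof (induction k rule: less_induct)
    case (less k)
    have IH: "z (Y.p j) = y (Y.p j)" if "j < k" for j using less that by simp
    have eq: "Z.p j = Y.p j" if "j \<le> k" for j
      using that by (induction j) (auto simp: Z.p_Suc Y.p_Suc IH)
    define i where "i = Y.p k"
    show ?case
    proof (rule ccontr)
      assume neq: "z (Y.p k) \<noteq> y (Y.p k)"
      hence zi: "z i = ?Y i" and zyi: "z i \<noteq> y i" using sub[of i] by (auto simp: i_def)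
      have k0: "k \<noteq> 0"
      proof
        assume "k = 0"
        hence "i = 1" by (simp add: i_def)
        thus False using one zi descend_one[OF B] by simp
      qed
      have i: "2 \<le> i" "i \<le> n"
        using Y.p_gt_1[of k] Y.p_range[of k] k0 less.prems by (auto simp: i_def)
      show False
      proof (cases "k < Y.M")
        case True
        have knB: "i \<notin> drops y" using Y.climb_not_drop[of k] True by (simp add: i_def)
        hence lt: "z i < i" using descend_less[OF B i] zi by simp
        \<comment> \<open>Up to position \<open>k\<close> both paths coincide, so \<open>z\<close>
          has not met \<open>n\<close> yet and \<open>climb_step\<close> applies to it.\<close>
        have "k < Z.M"
        proof (rule ccontr)
          assume "\<not> k < Z.M"
          hence "Y.p Z.M = n" using eq[of Z.M] Z.M by simp
          hence "Z.M = Y.M" using Y.p_inj[OF Z.M(1) Y.M(1)] Y.M by simp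
          thus False using True \<open>\<not> k < Z.M\<close> by simp
        qed
        moreover have pk: "Z.p k = i" "Z.p (Suc k) = z i" using eq[of k] by (simp_all add: i_def Z.p_Suc)
        ultimately have *: "Suc k < Z.M" "i = Suc (z i)" "i < Z.p (Suc (Suc k))"
          using Z.climb_step[of k] lt by auto
        define m where "m = z i"
        have m: "i = Suc m" "i < z m" using * pk Z.p_Suc[of "Suc k"] by (auto simp: m_def)
        have m1: "2 \<le> m" using Z.p_gt_1[of "Suc k"] * pk Z.M by (simp add: m_def)
        \<comment> \<open>Away from \<open>1\<close> the companion rises by at most one, so the arc
          from \<open>m\<close> to a city above \<open>i\<close> must belong to
          \<open>y\<close>.\<close>
        have "?Y m \<le> Suc m"
          using descend_block[OF B, of m] descend_less[OF B, of m] m1 m(1) i by (cases "m \<in> drops y") auto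
        hence ym: "i < y m" using sub[of m] m by auto
        obtain j where j: "j < n" "Y.p j = m" using Y.p_surj[of m] m1 m(1) i by auto
        have "k < j"
        proof (rule ccontr)
          assume "\<not> k < j"
          hence "Z.p j = Z.p (Suc k)" using j eq[of j] pk by (simp add: m_def)
          thus False using Z.p_inj[of j "Suc k"] j * Z.M(1) \<open>\<not> k < j\<close> by simp
        qed
        \<comment> \<open>City \<open>m < i\<close> comes after \<open>i\<close> on the path of
          \<open>y\<close>. If it were ascending, \<open>climb_later\<close> would place it above
          \<open>i\<close>; if descending, \<open>y m\<close> would be at most
          \<open>Suc m = i\<close>.\<close>
        show False
        proof (cases "j \<le> Y.M")
          case True
          have "j \<noteq> Suc k" using j zyi by (auto simp: Y.p_Suc m_def i_def)
          hence "Y.p k < Y.p j" using Y.climb_later[of k j] True \<open>k < j\<close> by simp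
          thus False using j m by (simp add: i_def)
        next
          case False
          define l where "l = n - Suc j"
          have l: "W.p (Suc l) = m" "l < W.M"
            using Y.path_inv[of "Suc l"] j False Y.M_inv by (auto simp: l_def Suc_diff_Suc)
          thus False using W.inv_p[of l] W.climb_drop_le[of l] ym m by simp
        qed
      next
        case False
        obtain j where j: "j < n" "Y.p j = z i"
          using Y.p_surj[of "z i"] Z.y_range[of i] i by auto
        \<comment> \<open>The target of the arc is not yet visited: returning to \<open>1\<close> is
          possible only at the end, where \<open>y\<close> does the same, and any other visited city
          already has its predecessor.\<close>
        have "k < j"
        proof (rule ccontr)
          assume "\<not> k < j"
          show False
          proof (cases j)
            case 0
            hence "Z.p (Suc k) = 1" using j eq[of k] by (simp add: Z.p_Suc i_def)
            hence "Suc k = n" using Z.p_gt_1[of "Suc k"] less.prems by fastforce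
            hence "y i = 1" using Y.p_n Y.p_Suc[of k] by (simp add: i_def)
            thus False using zyi 0 j by simp
          next
            case (Suc l)
            hence "z (Y.p l) = z i" using j IH[of l] \<open>\<not> k < j\<close> by (simp add: Y.p_Suc)
            hence "Y.p l = Y.p k" by (simp add: i_def)
            thus False using Y.p_inj[of l k] Suc j less.prems \<open>\<not> k < j\<close> by auto
          qed
        qed
        hence "j = Suc k" using Y.descend_later[of k j] False j zi by (simp add: i_def)
        thus False using j zyi by (simp add: Y.p_Suc i_def)
      qed
    qed
  qed
  show ?thesis
  proof
    fix i
    show "z i = y i"
    proof (cases "i \<in> {1..n}")
      case True
      then show ?thesis using agree Y.p_surj by blast
    next
      case False
      then show ?thesis using Y.perm Z.perm by (simp add: permutes_not_in)
    qed
  qed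
qed

lemma union_descend:
  assumes "3 \<le> n" "psb_tour n y" "psb_tour n z"
    and "\<And>i. z i = y i \<or> z i = descend n (drops y) i"
  shows "z = y \<or> z = descend n (drops y)"
  using union_descend_first[OF assms] union_descend_agree[OF assms] by blast

section \<open>Adjacency to the tour \<open>(1, 2, \<dots>, n)\<close>\<close>

text \<open>A member would be left by an arc rising by more than one, so it would be
  \<open>1\<close>; the predecessor of \<open>2\<close> would then be \<open>0\<close>, which is no
  city.\<close>

lemma drops_inv_descend:
  assumes n: "1 \<le> n" and B: "block_set n B"
  shows "drops (inv (descend n B)) = {}"
proof -
  let ?f = "descend n B"
  have perm: "?f permutes {1..n}"
    using hamiltonian_tour_descend[OF n B] by (simp add: hamiltonian_tour_def)
  have False if i: "i \<in> drops (inv ?f)" for i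
  proof -
    have up: "Suc i < ?f i" and down: "inv ?f (Suc i) < i"
      using i perm by (auto simp: drops_def permutes_bij inv_inv_eq)
    have "i \<in> {1..n}" using up permutes_not_in[OF perm, of i] by (intro ccontr[of "i \<in> _"]) auto
    moreover have "\<not> 2 \<le> i"
      using up descend_block[OF B, of i] descend_less[OF B, of i] calculation
      by (cases "i \<in> B") auto
    ultimately have "i = 1" by simp
    hence "inv ?f 2 = 0" using down by (simp add: numeral_2_eq_2)
    hence "?f 0 = 2" using permutes_inverses(1)[OF perm, of 2] by simp
    thus False using permutes_not_in[OF perm, of 0] by simp
  qed
  thus ?thesis by blast
qed

text \<open>This is \<open>union_descend\<close> for reversed tours:
  \<open>inv (descend n B)\<close> has no descending step-backs, so its companion is
  \<open>descend n {}\<close>.\<close>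

lemma union_ascend:
  assumes n: "3 \<le> n" and B: "block_set n B" and z: "psb_tour n z"
    and sub: "\<And>i. z i = descend n B i \<or> z i = inv (descend n {}) i"
  shows "z = descend n B \<or> z = inv (descend n {})"
proof -
  let ?D = "descend n B" and ?C = "inv (descend n {})"
  have D: "psb_tour n ?D" and D0: "psb_tour n (descend n {})"
    using psb_tour_descend[OF n] B by (auto simp: block_set_def)
  have bij: "bij ?D" "bij (descend n {})" "bij z"
    using D D0 z by (auto simp: psb_tour_def hamiltonian_tour_def permutes_bij)
  have drops: "drops (inv ?D) = {}" using drops_inv_descend[OF _ B] n by simp
  have "inv z i = inv ?D i \<or> inv z i = descend n {} i" for i
  proof -
    have "z (inv z i) = i" using bij by (simp add: bij_is_surj surj_f_inv_f)
    with sub[of "inv z i"] consider "?D (inv z i) = i" | "?C (inv z i) = i" by auto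
    then show ?thesis
    proof cases
      case 1
      then show ?thesis using bij by (metis bij_inv_eq_iff)
    next
      case 2
      then show ?thesis using bij by (metis bij_inv_eq_iff)
    qed
  qed
  hence "inv z = inv ?D \<or> inv z = descend n {}"
    using union_descend[OF n psb_tour_inv[OF D] psb_tour_inv[OF z]] drops by simp
  hence "inv (inv z) = inv (inv ?D) \<or> inv (inv z) = ?C" by auto
  thus ?thesis using bij by (simp add: inv_inv_eq)
qed

section \<open>From unions of arc sets to faces of the polytope\<close>

definition adjacent :: "nat \<Rightarrow> (nat \<Rightarrow> nat) \<Rightarrow> (nat \<Rightarrow> nat) \<Rightarrow> bool" where
  "adjacent n x y \<longleftrightarrow> psb_tour n x \<and> psb_tour n y \<and> x \<noteq> y \<and>
    (\<forall>z. psb_tour n z \<longrightarrow> (\<forall>i. z i = x i \<or> z i = y i) \<longrightarrow> z = x \<or> z = y)"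

text \<open>The functional \<open>a\<close> counts the arcs of a tour that lie in neither
  \<open>x\<close> nor \<open>y\<close>. It vanishes at these two and is positive at all other
  tours. Taking \<open>x = y\<close> also yields the vertices.\<close>

lemma tour_vector_face:
  fixes ends :: "'e::finite \<Rightarrow> nat \<times> nat"
  assumes n: "3 \<le> n" and ends: "bij_betw ends UNIV (Kn_arcs n)"
    and x: "psb_tour n x" and y: "psb_tour n y"
    and only: "\<And>z. psb_tour n z \<Longrightarrow> (\<And>i. z i = x i \<or> z i = y i) \<Longrightarrow> z = x \<or> z = y"
  shows "convex hull {tour_vector ends x, tour_vector ends y} face_of PSB n ends"
proof -
  let ?v = "tour_vector ends"
  let ?S = "{?v \<tau> | \<tau>. psb_tour n \<tau>}"
  define a :: "real ^ 'e" where
    "a = (\<chi> e. if snd (ends e) \<in> {x (fst (ends e)), y (fst (ends e))} then 0 else 1)"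
  have fin: "finite ?S"
  proof (rule finite_subset)
    show "?S \<subseteq> ?v ` {\<tau>. \<tau> permutes {1..n}}"
      by (auto simp: psb_tour_def hamiltonian_tour_def)
  qed (simp add: finite_permutations)
  have zero: "a \<bullet> ?v x = 0" "a \<bullet> ?v y = 0"
    by (auto simp: a_def tour_vector_def inner_vec_def intro!: sum.neutral)
  have pos: "a \<bullet> ?v z > 0" if z: "psb_tour n z" "z \<noteq> x" "z \<noteq> y" for z
  proof -
    interpret X: psb_path n x by unfold_locales fact+
    interpret Z: psb_path n z by unfold_locales fact+
    have "\<exists>i. z i \<noteq> x i \<and> z i \<noteq> y i"
      using only[OF z(1)] z(2,3) by auto
    then obtain i where i: "z i \<noteq> x i" "z i \<noteq> y i" by auto
    have "i \<in> {1..n}"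
    proof (rule ccontr)
      assume "i \<notin> {1..n}"
      hence "x i = i" "z i = i"
        using permutes_not_in[OF X.perm] permutes_not_in[OF Z.perm] by simp_all
      thus False using i by simp
    qed
    hence "(i, z i) \<in> Kn_arcs n" using Z.y_range Z.y_neq[of i] by (auto simp: Kn_arcs_def)
    then obtain e where e: "ends e = (i, z i)" using ends by (metis bij_betw_imp_surj_on imageE)
    have "0 < a $ e * ?v z $ e" using e i by (simp add: a_def tour_vector_def)
    also have "\<dots> \<le> (\<Sum>e\<in>UNIV. a $ e * ?v z $ e)"
      by (rule member_le_sum) (auto simp: a_def tour_vector_def)
    finally show ?thesis by (simp add: inner_vec_def)
  qed
  have "affine hull {?v x, ?v y} \<subseteq> {w. a \<bullet> w = 0}"
    using zero by (intro hull_minimal) (auto simp: affine_hyperplane)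
  moreover have "convex hull (?S - {?v x, ?v y}) \<subseteq> {w. a \<bullet> w > 0}"
    using pos by (intro hull_minimal) (auto simp: convex_halfspace_gt)
  ultimately have "affine hull {?v x, ?v y} \<inter> convex hull (?S - {?v x, ?v y}) = {}" by force
  thus ?thesis unfolding PSB_def
    using x y by (intro face_of_convex_hulls[OF fin]) auto
qed

lemma tour_vector_inj:
  fixes ends :: "'e::finite \<Rightarrow> nat \<times> nat"
  assumes n: "3 \<le> n" and ends: "bij_betw ends UNIV (Kn_arcs n)"
    and x: "psb_tour n x" and y: "psb_tour n y" and eq: "tour_vector ends x = tour_vector ends y"
  shows "x = y"
proof
  fix i
  interpret X: psb_path n x by unfold_locales fact+
  interpret Y: psb_path n y by unfold_locales fact+
  show "x i = y i"
  proof (cases "i \<in> {1..n}")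
    case True
    hence "(i, x i) \<in> Kn_arcs n" using X.y_range X.y_neq[of i] by (auto simp: Kn_arcs_def)
    then obtain e where e: "ends e = (i, x i)" using ends by (metis bij_betw_imp_surj_on imageE)
    have "tour_vector ends x $ e = tour_vector ends y $ e" using eq by simp
    thus ?thesis using e by (simp add: tour_vector_def split: if_splits)
  next
    case False
    then show ?thesis using permutes_not_in[OF X.perm] permutes_not_in[OF Y.perm] by simp
  qed
qed

lemma skeleton_verts_PSB:
  fixes ends :: "'e::finite \<Rightarrow> nat \<times> nat"
  assumes "3 \<le> n" "bij_betw ends UNIV (Kn_arcs n)"
  shows "skeleton_verts (PSB n ends) = {tour_vector ends \<tau> | \<tau>. psb_tour n \<tau>}"
proof
  show "skeleton_verts (PSB n ends) \<subseteq> {tour_vector ends \<tau> | \<tau>. psb_tour n \<tau>}"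
    using extreme_point_of_convex_hull by (auto simp: skeleton_verts_def PSB_def)
next
  have "tour_vector ends x extreme_point_of PSB n ends" if "psb_tour n x" for x
    using tour_vector_face[OF assms that that] by (auto simp: face_of_singleton)
  thus "{tour_vector ends \<tau> | \<tau>. psb_tour n \<tau>} \<subseteq> skeleton_verts (PSB n ends)"
    by (auto simp: skeleton_verts_def)
qed

lemma adjacent_skeleton_edge:
  fixes ends :: "'e::finite \<Rightarrow> nat \<times> nat"
  assumes n: "3 \<le> n" and ends: "bij_betw ends UNIV (Kn_arcs n)" and adj: "adjacent n x y"
  shows "(tour_vector ends x, tour_vector ends y) \<in> skeleton_edges (PSB n ends)"
proof -
  let ?v = "tour_vector ends"
  have x: "psb_tour n x" and y: "psb_tour n y" and "x \<noteq> y"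
    using adj by (auto simp: adjacent_def)
  hence neq: "?v x \<noteq> ?v y" using tour_vector_inj[OF n ends] by blast
  have "convex hull {?v x, ?v y} face_of PSB n ends"
    using adj by (intro tour_vector_face[OF n ends x y]) (auto simp: adjacent_def)
  hence "convex hull {?v x, ?v y} edge_of PSB n ends"
    using neq by (simp add: edge_of_def aff_dim_convex_hull)
  thus ?thesis using x y neq skeleton_verts_PSB[OF n ends]
    by (auto simp: skeleton_edges_def intro!: exI[of _ "convex hull {?v x, ?v y}"] hull_inc)
qed

lemma edge_dist_le:
  assumes "(x, y) \<in> E ^^ k"
  shows "edge_dist E x y \<le> enat k"
  unfolding edge_dist_def using assms by (intro INF_lower) simp

theorem theorem3:
  fixes n :: nat and ends :: "'e::finite \<Rightarrow> nat \<times> nat"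
  assumes "n \<ge> 3"
    and "bij_betw ends UNIV (Kn_arcs n)"
  shows "skeleton_diameter (PSB n ends) \<le> 4"
proof -
  let ?E = "skeleton_edges (PSB n ends)" and ?v = "tour_vector ends"
  let ?c = "inv (descend n {})"
  have E0: "block_set n {}" by (simp add: block_set_def)
  have c: "psb_tour n ?c" using psb_tour_inv[OF psb_tour_descend[OF assms(1) E0]] .
  \<comment> \<open>Distinctness for \<open>adjacent\<close>: equality would force
    \<open>descend n {}\<close> to send \<open>n\<close> to \<open>1\<close>, but it sends
    \<open>n\<close> to \<open>n - 1\<close>, which exceeds \<open>1\<close>.\<close>
  have c_not: "?c \<noteq> descend n B" if "block_set n B" for B
  proof
    assume eq: "?c = descend n B"
    have "?c 1 = n" using eq descend_one[OF that] by simp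
    hence "descend n {} n = 1" using hamiltonian_tour_descend[OF _ E0] assms(1)
      by (metis (no_types, lifting) hamiltonian_tour_def le_trans one_le_numeral permutes_inverses(1))
    thus False using assms(1) by (simp add: descend_def swp_def rot_def)
  qed
  have sym: "(b, a) \<in> ?E" if "(a, b) \<in> ?E" for a b
    using that by (auto simp: skeleton_edges_def)
  \<comment> \<open>The length is at most two because \<open>x\<close> may already be its own
    companion. Both directions are kept, since the second half of the walk leaves
    \<open>c\<close>.\<close>
  have to_c: "\<exists>k\<le>2. (?v x, ?v ?c) \<in> ?E ^^ k \<and> (?v ?c, ?v x) \<in> ?E ^^ k" if x: "psb_tour n x" for x
  proof -
    interpret X: psb_path n x using assms(1) x by unfold_locales
    let ?d = "descend n (drops x)"
    have B: "block_set n (drops x)" by (rule X.block_set_drops)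
    have d: "psb_tour n ?d" by (rule psb_tour_descend) fact+
    have "adjacent n ?d ?c"
      using d c c_not[OF B] union_ascend[OF assms(1) B] unfolding adjacent_def by metis
    hence dc: "(?v ?d, ?v ?c) \<in> ?E" by (rule adjacent_skeleton_edge[OF assms])
    show ?thesis
    proof (cases "x = ?d")
      case True
      hence "(?v x, ?v ?c) \<in> ?E ^^ 1" "(?v ?c, ?v x) \<in> ?E ^^ 1" using dc sym by auto
      thus ?thesis by (intro exI[of _ 1]) auto
    next
      case False
      hence "adjacent n x ?d"
        using d x union_descend[OF assms(1) x] unfolding adjacent_def by metis
      hence "(?v x, ?v ?d) \<in> ?E" by (rule adjacent_skeleton_edge[OF assms])
      hence "(?v x, ?v ?c) \<in> ?E ^^ 2" "(?v ?c, ?v x) \<in> ?E ^^ 2"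
        using dc sym by (auto simp: numeral_2_eq_2)
      thus ?thesis by blast
    qed
  qed
  have "edge_dist ?E a b \<le> 4"
    if a: "a \<in> skeleton_verts (PSB n ends)" and b: "b \<in> skeleton_verts (PSB n ends)" for a b
  proof -
    obtain x y where xy: "psb_tour n x" "a = ?v x" "psb_tour n y" "b = ?v y"
      using a b skeleton_verts_PSB[OF assms] by auto
    obtain k l where "k \<le> 2" "(a, ?v ?c) \<in> ?E ^^ k" "l \<le> 2" "(?v ?c, b) \<in> ?E ^^ l"
      using to_c[OF xy(1)] to_c[OF xy(3)] xy by blast
    hence "(a, b) \<in> ?E ^^ (k + l)" "k + l \<le> 4" by (auto simp: relpow_add)
    thus ?thesis using edge_dist_le[of a b "k + l" ?E]
      by (metis enat_ord_simps(1) numeral_eq_enat order_trans)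
  qed
  thus ?thesis unfolding skeleton_diameter_def by (intro SUP_least) auto
qed

end
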